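(* Let $A \in \mathbb{Z}^{m \times n}$ have columns $a^1,\dots,a^n$, and let $K \subset \mathbb{R}^m$ be a closed, convex, pointed cone. Then for every integer $k \ge 1$ and every $\beta\in\mathbb{R}^m$, $$F_+^k(\beta)=\max\Big\{F_+^{k-1}(\beta),\ \max_{j\in\{1,\dots,n\}} F_+^{k-1}(\beta-a^j)\Big\}.$$
   Context: For $\beta^1,\beta^2\in\mathbb{R}^m$, $\beta^1 \preceq_K \beta^2$ means $\beta^2-\beta^1 \in K$. $\mathbb{Z}_+$ denotes the nonnegative integers and $1$ also denotes the all-ones vector. For $\beta\in\mathbb{R}^m$ and $k\in\mathbb{Z}_+$, $\mathbf{P}_+^k(\beta)=\{x\in\mathbb{Z}^n_+ : Ax\preceq_K\beta,\ 1^Tx\le k\}$, and $F_+^k:\mathbb{R}^m\to\mathbb{R}$ is defined by $F_+^k(\beta)=0$ if $\mathbf{P}_+^k(\beta)\neq\emptyset$ and $F_+^k(\beta)=-1$ if $\mathbf{P}_+^k(\beta)=\emptyset$. *)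

theory Defs
  imports "HOL-Analysis.Analysis"
begin

definition real_vec :: "int ^ 'm \<Rightarrow> real ^ 'm" where
  "real_vec v = (\<chi> i. real_of_int (v $ i))"

text \<open>\<^const>\<open>cone\<close> is closed under scaling by all nonnegative reals but also admits the empty set; the
  equality with \<^term>\<open>{0}\<close> below additionally forces \<^term>\<open>0 \<in> K\<close>.\<close>

definition pointed :: "(real ^ 'm) set \<Rightarrow> bool" where
  "pointed K \<longleftrightarrow> K \<inter> uminus ` K = {0}"

definition cone_le :: "(real ^ 'm) set \<Rightarrow> real ^ 'm \<Rightarrow> real ^ 'm \<Rightarrow> bool" where
  "cone_le K \<beta>1 \<beta>2 \<longleftrightarrow> \<beta>2 - \<beta>1 \<in> K"

definition P_plus :: "int ^ 'n ^ 'm \<Rightarrow> (real ^ 'm) set \<Rightarrow> nat \<Rightarrow> real ^ 'm \<Rightarrow> (int ^ 'n) set" where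
  "P_plus A K k \<beta> =
    {x. (\<forall>j. 0 \<le> x $ j) \<and> cone_le K (real_vec (A *v x)) \<beta> \<and> (\<Sum>j\<in>UNIV. x $ j) \<le> int k}"

definition F_plus :: "int ^ 'n ^ 'm \<Rightarrow> (real ^ 'm) set \<Rightarrow> nat \<Rightarrow> real ^ 'm \<Rightarrow> real" where
  "F_plus A K k \<beta> = (if P_plus A K k \<beta> \<noteq> {} then 0 else - 1)"

end

theory Submission
  imports Defs
begin

text \<open>A feasible point of coordinate sum at most \<open>k\<close> either has sum at most \<open>k - 1\<close> or has a positive
  coordinate \<open>j\<close>; lowering that coordinate by one shifts the right-hand side by the column \<open>a\<^sup>j\<close>.\<close>

lemma real_vec_add: "real_vec (u + v) = real_vec u + real_vec v"
  by (simp add: real_vec_def vec_eq_iff)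

lemma matrix_vector_mult_axis: "A *v axis j 1 = column j A" for A :: "'a::semiring_1 ^ 'n ^ 'm"
  by (simp add: matrix_vector_mult_def column_def axis_def vec_eq_iff if_distrib cong: if_cong)

text \<open>A unit step in coordinate \<open>j\<close> raises the coordinate sum by one and
  \<open>A *v x\<close> by column \<open>j\<close>, so both constraints shift together.
  Nonnegativity of \<open>x\<close> is assumed because it does not follow from that of
  \<open>x + axis j 1\<close>. Read from left to right this removes a unit, from right to left it
  adds one.\<close>

lemma P_plus_Suc_add_axis_iff:
  assumes "\<And>i. 0 \<le> x $ i"
  shows "x + axis j 1 \<in> P_plus A K (Suc k) \<beta> \<longleftrightarrow> x \<in> P_plus A K k (\<beta> - real_vec (column j A))"
proof -
  have "(\<Sum>i\<in>UNIV. (x + axis j 1) $ i) = (\<Sum>i\<in>UNIV. x $ i) + 1"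
    by (simp add: sum.distrib axis_def)
  moreover have "real_vec (A *v (x + axis j 1)) = real_vec (A *v x) + real_vec (column j A)"
    by (simp add: matrix_vector_right_distrib matrix_vector_mult_axis real_vec_add)
  moreover have "0 \<le> (x + axis j 1) $ i" for i
    using assms[of i] by (simp add: axis_def)
  ultimately show ?thesis
    using assms by (simp add: P_plus_def cone_le_def algebra_simps)
qed

lemma P_plus_Suc_nonempty_iff:
  "P_plus A K (Suc k) \<beta> \<noteq> {} \<longleftrightarrow>
    P_plus A K k \<beta> \<noteq> {} \<or> (\<exists>j. P_plus A K k (\<beta> - real_vec (column j A)) \<noteq> {})"
proof
  assume "P_plus A K (Suc k) \<beta> \<noteq> {}"
  then obtain x where x: "x \<in> P_plus A K (Suc k) \<beta>" by blast
  then have nonneg: "0 \<le> x $ i" for i by (simp add: P_plus_def)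
  show "P_plus A K k \<beta> \<noteq> {} \<or> (\<exists>j. P_plus A K k (\<beta> - real_vec (column j A)) \<noteq> {})"
  proof (cases "\<exists>j. x $ j > 0")
    case True
    then obtain j where j: "x $ j > 0" ..
    \<comment> \<open>Integrality enters here: \<open>x $ j > 0\<close> means \<open>x $ j\<close>
      is at least 1.\<close>
    have "0 \<le> (x - axis j 1) $ i" for i
      using nonneg[of i] j by (simp add: axis_def)
    from P_plus_Suc_add_axis_iff[OF this, of j A K k \<beta>] x
    have "x - axis j 1 \<in> P_plus A K k (\<beta> - real_vec (column j A))" by simp
    then show ?thesis by blast
  next
    case False
    \<comment> \<open>Now \<open>x\<close> is the zero vector, whose coordinate sum meets every
      bound, even for \<open>k = 0\<close>.\<close>
    with nonneg have "x $ j = 0" for j by (meson antisym not_less)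
    with x have "x \<in> P_plus A K k \<beta>" by (simp add: P_plus_def)
    then show ?thesis by blast
  qed
next
  have "P_plus A K k \<beta> \<subseteq> P_plus A K (Suc k) \<beta>"
    by (auto simp: P_plus_def)
  moreover have "P_plus A K (Suc k) \<beta> \<noteq> {}"
    if "x \<in> P_plus A K k (\<beta> - real_vec (column j A))" for x j
  proof -
    from that have "0 \<le> x $ i" for i by (simp add: P_plus_def)
    \<comment> \<open>The witness is \<open>x + axis j 1\<close>.\<close>
    from P_plus_Suc_add_axis_iff[OF this, of j A K k \<beta>] that show ?thesis by auto
  qed
  ultimately show "P_plus A K (Suc k) \<beta> \<noteq> {}"
    if "P_plus A K k \<beta> \<noteq> {} \<or> (\<exists>j. P_plus A K k (\<beta> - real_vec (column j A)) \<noteq> {})"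
    using that by blast
qed

text \<open>As \<open>F_plus\<close> takes only the values -1 and 0, its maximum over a finite
  family encodes an existential. This turns the recursion into a statement about
  nonemptiness.\<close>

lemma Max_F_plus:
  fixes b :: "'a::finite \<Rightarrow> real ^ 'm"
  shows "(MAX j\<in>UNIV. F_plus A K k (b j)) = (if \<exists>j. P_plus A K k (b j) \<noteq> {} then 0 else - 1)"
  by (intro Max_eqI) (auto simp: F_plus_def image_iff)

theorem proposition8:
  fixes A :: "int ^ 'n ^ 'm" and K :: "(real ^ 'm) set" and k :: nat and \<beta> :: "real ^ 'm"
  assumes "closed K" and "convex K" and "cone K" and "pointed K"
    and "k \<ge> 1"
  shows "F_plus A K k \<beta> =
    max (F_plus A K (k - 1) \<beta>) (MAX j\<in>UNIV. F_plus A K (k - 1) (\<beta> - real_vec (column j A)))"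
proof -
  obtain l where "k = Suc l" using \<open>k \<ge> 1\<close> by (cases k) auto
  then show ?thesis
    \<comment> \<open>\<open>Max_F_plus\<close> has to rewrite the maximum while
      \<open>F_plus\<close> is still folded; only then is \<open>F_plus\<close> unfolded.\<close>
    using P_plus_Suc_nonempty_iff[of A K l \<beta>] by (simp add: Max_F_plus) (simp add: F_plus_def)
qed

end
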